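(* For every integer $a\geq 1$ and every integer $r\geq 2$, the pair of polynomials $$\left(T_{a+r}Q_{r-2}^{(a)},\; U_{a+r+1}Q_{r-1}^{(a)}\right)$$ is compatible. Consequently, every $Q_r^{(a)}$ has only nonpositive real zeros.
   Context: For a positive integer $n$ and $f\in\mathbb R[x]$ define $$(T_nf)(x)=\bigl(1+(n-1)x\bigr)f(x)+x(1-x)f'(x),\qquad (U_nf)(x)=(n-1)xf(x)+x(1-x)f'(x).$$ For an integer $a\geq 1$ define polynomials $Q_r^{(a)}\in\mathbb R[x]$ by $Q_0^{(a)}=1$ and $$Q_r^{(a)}=T_{a+r+1}Q_{r-1}^{(a)}+(-1)^r\qquad (r\geq 1).$$ A polynomial is real-rooted if all its complex zeros are real; the zero polynomial is counted as real-rooted. A finite family $f_1,\dots,f_s$ of real polynomials is compatible if $\lambda_1f_1+\cdots+\lambda_sf_s$ is real-rooted for all $\lambda_1,\dots,\lambda_s\geq 0$. *)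

theory Defs
  imports Complex_Main "HOL-Computational_Algebra.Polynomial"
begin

definition T_op :: "nat \<Rightarrow> real poly \<Rightarrow> real poly" where
  "T_op n f = [:1, real n - 1:] * f + [:0, 1:] * [:1, - 1:] * pderiv f"

definition U_op :: "nat \<Rightarrow> real poly \<Rightarrow> real poly" where
  "U_op n f = [:0, real n - 1:] * f + [:0, 1:] * [:1, - 1:] * pderiv f"

fun Q_poly :: "nat \<Rightarrow> nat \<Rightarrow> real poly" where
  "Q_poly a 0 = 1"
| "Q_poly a (Suc r) = T_op (a + Suc r + 1) (Q_poly a r) + (- 1) ^ Suc r"

definition real_rooted :: "real poly \<Rightarrow> bool" where
  "real_rooted f \<longleftrightarrow> f = 0 \<or> (\<forall>z::complex. poly (map_poly of_real f) z = 0 \<longrightarrow> z \<in> \<real>)"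

(* A finite family is given as a list, so repeated members are allowed. *)
definition compatible :: "real poly list \<Rightarrow> bool" where
  "compatible fs \<longleftrightarrow>
     (\<forall>c::nat \<Rightarrow> real. (\<forall>i<length fs. 0 \<le> c i) \<longrightarrow>
        real_rooted (\<Sum>i<length fs. smult (c i) (fs ! i)))"

end

theory Submission
  imports Defs
begin

text \<open>
  For polynomials with positive leading coefficient and only real zeros, count the zeros in
  \<open>[t, \<infinity>)\<close> with multiplicity. If the counts of \<open>p\<close> and \<open>q\<close> never differ by more than one, then
  \<open>p + q\<close> has only real zeros and its count lies between the two: cancel common zeros and
  apply the intermediate value theorem. This also gives Rolle-type statements for free.

  With \<open>L\<^sub>n g = n g + (1 - x) g'\<close> one has \<open>T\<^sub>n f = L\<^sub>n (x f)\<close> and \<open>U\<^sub>n\<^sub>+\<^sub>1 g = x L\<^sub>n g\<close>. Moving a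
  zero to the right is additive, \<open>L\<^sub>n ((x - v) g) = L\<^sub>n ((x - w) g) + (w - v) L\<^sub>n g\<close>, so the counts of
  \<open>L\<^sub>n g\<close> are monotone in those of \<open>g\<close>. Hence close counts of \<open>f\<close> and \<open>g\<close> give close counts of
  \<open>T\<^sub>n f\<close> and \<open>U\<^sub>n\<^sub>+\<^sub>1 g\<close>.

  Finally \<open>Q\<^sub>r = T\<^sub>a\<^sub>+\<^sub>r Q\<^sub>r\<^sub>-\<^sub>2 + U\<^sub>a\<^sub>+\<^sub>r\<^sub>+\<^sub>1 Q\<^sub>r\<^sub>-\<^sub>1\<close>. The counts of \<open>Q\<^sub>r\<^sub>-\<^sub>1\<close> are close to those of \<open>T\<^sub>a\<^sub>+\<^sub>r Q\<^sub>r\<^sub>-\<^sub>2\<close>,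
  from which it differs by a constant, so that both interlace with the same derivative, and to
  those of \<open>U\<^sub>a\<^sub>+\<^sub>r\<^sub>+\<^sub>1 Q\<^sub>r\<^sub>-\<^sub>1\<close>; hence they are close to those of the sum \<open>Q\<^sub>r\<close>.
\<close>

section \<open>Real-rooted polynomials and their root counts\<close>

text \<open>The inductive form gives an induction that adds one root at a time. The positive
  constant keeps leading coefficients positive, so that they cannot cancel in a sum.\<close>

inductive real_split :: "real poly \<Rightarrow> bool" where
  const: "0 < c \<Longrightarrow> real_split [:c:]"
| linear: "real_split p \<Longrightarrow> real_split ([:- v, 1:] * p)"

definition roots_ge :: "real \<Rightarrow> real poly \<Rightarrow> nat" where
  "roots_ge t p = size {#v \<in># proots p. t \<le> v#}"

lemma real_split_lead_coeff: "real_split p \<Longrightarrow> 0 < lead_coeff p"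
proof (induction rule: real_split.induct)
  case (linear p v)
  then show ?case by (simp only: lead_coeff_mult) simp
qed simp

lemma real_split_nonzero: "real_split p \<Longrightarrow> p \<noteq> 0"
  using real_split_lead_coeff by fastforce

lemma real_split_size_proots: "real_split p \<Longrightarrow> size (proots p) = degree p"
proof (induction rule: real_split.induct)
  case (linear p v)
  have "degree ([:- v, 1:] * p) = Suc (degree p)"
    using real_split_nonzero[OF linear.hyps] by (subst degree_mult_eq) auto
  then show ?case
    using linear real_split_nonzero[OF linear.hyps] by (subst proots_mult) auto
qed simp

lemma degree_linear_mult: "p \<noteq> 0 \<Longrightarrow> degree ([:- v, 1:] * p) = Suc (degree (p :: real poly))"
  by (subst degree_mult_eq) auto

text \<open>Peel off one root at a time; the equality of root number and degree is inherited by the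
  quotient. This is the criterion by which a sum is recognised as split.\<close>

lemma real_splitI_size:
  assumes "0 < lead_coeff p" "size (proots p) = degree p"
  shows "real_split p"
  using assms
proof (induction "degree p" arbitrary: p)
  case 0
  then obtain c where "p = [:c:]" by (metis degree_eq_zeroE)
  with 0 show ?case by (auto intro: real_split.const)
next
  case (Suc n)
  have nz: "p \<noteq> 0" using Suc by auto
  have "proots p \<noteq> {#}" using Suc by auto
  then obtain v where "v \<in># proots p" by blast
  then have "poly p v = 0" using nz by simp
  then obtain q where q: "p = [:- v, 1:] * q" by (metis poly_eq_0_iff_dvd dvdE)
  have qnz: "q \<noteq> 0" using nz q by auto
  have "degree p = Suc (degree q)" unfolding q by (rule degree_linear_mult[OF qnz])
  moreover have "size (proots p) = Suc (size (proots q))"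
    unfolding q using qnz by (subst proots_mult) auto
  moreover have "lead_coeff p = lead_coeff q" unfolding q by (simp only: lead_coeff_mult) simp
  ultimately have "real_split q" using Suc by auto
  then show ?case unfolding q by (rule real_split.linear)
qed

lemma real_split_root:
  assumes "real_split p" "poly p v = 0"
  obtains q where "p = [:- v, 1:] * q" "real_split q"
proof -
  obtain q where q: "p = [:- v, 1:] * q" using assms(2) by (metis poly_eq_0_iff_dvd dvdE)
  have nz: "p \<noteq> 0" by (rule real_split_nonzero[OF assms(1)])
  then have qnz: "q \<noteq> 0" using q by auto
  have "degree p = Suc (degree q)" unfolding q by (rule degree_linear_mult[OF qnz])
  moreover have "size (proots p) = Suc (size (proots q))"
    unfolding q using qnz by (subst proots_mult) auto
  moreover have "lead_coeff p = lead_coeff q" unfolding q by (simp only: lead_coeff_mult) simp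
  ultimately have "real_split q"
    using real_split_size_proots[OF assms(1)] real_split_lead_coeff[OF assms(1)]
    by (intro real_splitI_size) auto
  with q that show ?thesis by blast
qed

lemma real_split_smult: "real_split p \<Longrightarrow> 0 < c \<Longrightarrow> real_split (smult c p)"
  using real_split_lead_coeff real_split_size_proots by (intro real_splitI_size) auto

lemma real_split_mult: "real_split p \<Longrightarrow> real_split q \<Longrightarrow> real_split (p * q)"
proof (induction rule: real_split.induct)
  case (const c)
  then show ?case by (simp add: real_split_smult)
next
  case (linear p v)
  then show ?case by (metis mult.assoc real_split.linear)
qed

lemma roots_ge_const [simp]: "roots_ge t [:c:] = 0"
  by (simp add: roots_ge_def)

lemma roots_ge_mult: "p \<noteq> 0 \<Longrightarrow> q \<noteq> 0 \<Longrightarrow> roots_ge t (p * q) = roots_ge t p + roots_ge t q"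
  by (simp add: roots_ge_def proots_mult)

lemma roots_ge_linear:
  "real_split p \<Longrightarrow> roots_ge t ([:- v, 1:] * p) = of_bool (t \<le> v) + roots_ge t p"
  using real_split_nonzero[of p] by (subst roots_ge_mult) (auto simp: roots_ge_def)

lemma roots_ge_smult: "c \<noteq> 0 \<Longrightarrow> roots_ge t (smult c p) = roots_ge t p"
  by (simp add: roots_ge_def)

lemma roots_ge_pos_iff:
  assumes "real_split p"
  shows "0 < roots_ge t p \<longleftrightarrow> (\<exists>v. t \<le> v \<and> poly p v = 0)"
proof -
  have "set_mset (proots p) = {x. poly p x = 0}"
    using real_split_nonzero[OF assms] by simp
  then show ?thesis
    unfolding roots_ge_def nonempty_has_size[symmetric] set_mset_eq_empty_iff[symmetric] by auto
qed

text \<open>Each linear factor whose root lies beyond \<open>t\<close> is negative at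
  \<open>t\<close>; all other factors and the constant are positive.\<close>

lemma real_split_sign:
  assumes "real_split p" "poly p t \<noteq> 0"
  shows "0 < (- 1) ^ roots_ge t p * poly p t"
  using assms
proof (induction rule: real_split.induct)
  case (linear p v)
  then have "t \<noteq> v" and pos: "0 < (- 1) ^ roots_ge t p * poly p t" by auto
  have "(- 1) ^ roots_ge t ([:- v, 1:] * p) * poly ([:- v, 1:] * p) t
      = ((- 1) ^ of_bool (t \<le> v) * (t - v)) * ((- 1) ^ roots_ge t p * poly p t)"
    by (simp add: roots_ge_linear[OF linear.hyps] power_add del: mult_pCons_left)
  also have "0 < \<dots>"
    by (rule mult_pos_pos[OF _ pos]) (use \<open>t \<noteq> v\<close> in auto)
  finally show ?case .
qed simp

lemma length_filter_sorted_desc: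
  fixes xs :: "'a::linorder list"
  assumes "sorted_wrt (\<ge>) xs"
  shows "i < length (filter (\<lambda>v. t \<le> v) xs) \<longleftrightarrow> i < length xs \<and> t \<le> xs ! i"
  using assms
proof (induction xs arbitrary: i)
  case (Cons x xs)
  show ?case
  proof (cases "t \<le> x")
    case True
    with Cons show ?thesis by (cases i) auto
  next
    case False
    then have "\<forall>y\<in>set xs. \<not> t \<le> y" using Cons.prems by auto
    with False have "filter (\<lambda>v. t \<le> v) (x # xs) = []" by (simp add: filter_empty_conv)
    moreover have "i < length (x # xs) \<Longrightarrow> \<not> t \<le> (x # xs) ! i"
      using \<open>\<forall>y\<in>set xs. \<not> t \<le> y\<close> False by (metis nth_mem set_ConsD)
    ultimately show ?thesis by auto
  qed
qed simp

text \<open>Sort the roots in decreasing order. The equivalence encodes this order and turns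
  inequalities between counts into inequalities between the roots of equal index.\<close>

lemma real_split_root_seq:
  assumes "real_split p"
  obtains v where "\<And>i t. i < roots_ge t p \<longleftrightarrow> i < degree p \<and> t \<le> v i"
    and "\<And>i. i < degree p \<Longrightarrow> poly p (v i) = 0"
proof -
  define xs where "xs = rev (sorted_list_of_multiset (proots p))"
  have m: "mset xs = proots p" by (simp add: xs_def)
  have len: "length xs = degree p"
    using real_split_size_proots[OF assms] m by (metis size_mset)
  have srt: "sorted_wrt (\<ge>) xs"
    unfolding xs_def sorted_wrt_rev by (simp add: sorted_sorted_list_of_multiset)
  have cnt: "roots_ge t p = length (filter (\<lambda>v. t \<le> v) xs)" for t
    unfolding roots_ge_def by (metis m mset_filter size_mset)
  have "poly p (xs ! i) = 0" if "i < degree p" for i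
  proof -
    have "xs ! i \<in># proots p" using that len m by (metis nth_mem set_mset_mset)
    then show ?thesis using real_split_nonzero[OF assms] by simp
  qed
  then show ?thesis
    using that[of "\<lambda>i. xs ! i"] length_filter_sorted_desc[OF srt] cnt len by metis
qed

text \<open>The reflected polynomial \<open>(- 1) ^ degree p * p (- x)\<close> has the same leading
  coefficient as \<open>p\<close>, so its sign near plus infinity is known.\<close>

lemma poly_sign_at_bot:
  fixes p :: "real poly"
  assumes "0 < lead_coeff p"
  obtains b where "\<And>t. t \<le> b \<Longrightarrow> 0 < (- 1) ^ degree p * poly p t"
proof -
  define q where "q = smult ((- 1) ^ degree p) (pcompose p [:0, - 1:])"
  have "lead_coeff (pcompose p [:0, - 1:]) = lead_coeff p * (- 1) ^ degree p"
    by (subst lead_coeff_comp) auto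
  then have "lead_coeff q = lead_coeff p"
    by (simp add: q_def power_add[symmetric] mult.left_commute)
  then obtain n where n: "\<forall>x\<ge>n. lead_coeff q \<le> poly q x"
    using poly_pinfty_gt_lc[of q] assms by auto
  have "0 < (- 1) ^ degree p * poly p t" if "t \<le> - n" for t
  proof -
    have "lead_coeff q \<le> poly q (- t)" using n that by auto
    then show ?thesis using assms \<open>lead_coeff q = lead_coeff p\<close> by (simp add: q_def poly_pcompose)
  qed
  then show ?thesis using that by blast
qed

section \<open>Sums of polynomials with close root counts\<close>

definition close_roots :: "real poly \<Rightarrow> real poly \<Rightarrow> bool" where
  "close_roots p q \<longleftrightarrow> (\<forall>t. roots_ge t p \<le> roots_ge t q + 1 \<and> roots_ge t q \<le> roots_ge t p + 1)"

lemma close_roots_sym: "close_roots p q \<Longrightarrow> close_roots q p"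
  by (auto simp: close_roots_def)

text \<open>If the degree of \<open>p\<close> were larger, the count of \<open>q\<close> at the root
  of \<open>p\<close> with index \<open>degree q + k\<close> would exceed
  \<open>degree q\<close>.\<close>

lemma degree_le_of_roots_ge:
  assumes "real_split p" "real_split q" "\<And>t. roots_ge t p \<le> roots_ge t q + k"
  shows "degree p \<le> degree q + k"
proof -
  obtain v where v: "\<And>i t. i < roots_ge t p \<longleftrightarrow> i < degree p \<and> t \<le> v i"
    using real_split_root_seq[OF assms(1)] by metis
  obtain w where w: "\<And>i t. i < roots_ge t q \<longleftrightarrow> i < degree q \<and> t \<le> w i"
    using real_split_root_seq[OF assms(2)] by metis
  show ?thesis
  proof (rule ccontr)
    assume "\<not> ?thesis"
    then have "degree q + k < roots_ge (v (degree q + k)) p" by (simp add: v)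
    then have "degree q < roots_ge (v (degree q + k)) q"
      using assms(3) by (metis add_less_cancel_right less_le_trans)
    then show False by (simp add: w)
  qed
qed

text \<open>The roots of equal index of \<open>p\<close> and \<open>q\<close>, both listed
  decreasingly, bound an interval on which \<open>p + q\<close> changes sign. These intervals do not
  overlap, so they give as many roots as the degree. The root with index \<open>i\<close> lies
  between the two roots with index \<open>i\<close>, which yields the bounds on the counts.\<close>

lemma add_without_common_root:
  assumes p: "real_split p" and q: "real_split q" and close: "close_roots p q"
    and deg: "degree q \<le> degree p"
    and disj: "\<And>x. poly p x = 0 \<Longrightarrow> poly q x \<noteq> 0"
  shows "real_split (p + q)
    \<and> (\<forall>t. min (roots_ge t p) (roots_ge t q) \<le> roots_ge t (p + q)
         \<and> roots_ge t (p + q) \<le> max (roots_ge t p) (roots_ge t q))"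
proof -
  define m k where "m = degree p" and "k = degree q"
  have km: "k \<le> m" "m \<le> k + 1"
    using deg degree_le_of_roots_ge[OF p q, of 1] close by (auto simp: m_def k_def close_roots_def)
  have degpq: "degree (p + q) = m" and lc: "0 < lead_coeff (p + q)"
  proof -
    have "0 < coeff p m" using real_split_lead_coeff[OF p] by (simp add: m_def)
    moreover have "0 \<le> coeff q m"
      using real_split_lead_coeff[OF q] km by (cases "k = m") (auto simp: k_def coeff_eq_0)
    ultimately have "0 < coeff (p + q) m" by simp
    moreover have "degree (p + q) \<le> m" using deg by (auto simp: m_def intro: degree_add_le)
    ultimately show "degree (p + q) = m" by (metis le_antisym le_degree less_irrefl)
    with \<open>0 < coeff (p + q) m\<close> show "0 < lead_coeff (p + q)" by simp
  qed
  obtain v where v: "\<And>i t. i < roots_ge t p \<longleftrightarrow> i < m \<and> t \<le> v i"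
    and v0: "\<And>i. i < m \<Longrightarrow> poly p (v i) = 0"
    using real_split_root_seq[OF p] unfolding m_def by metis
  obtain w where w: "\<And>i t. i < roots_ge t q \<longleftrightarrow> i < k \<and> t \<le> w i"
    and w0: "\<And>i. i < k \<Longrightarrow> poly q (w i) = 0"
    using real_split_root_seq[OF q] unfolding k_def by metis
  have pq: "i < roots_ge t q" if "Suc i < roots_ge t p" for i t
    using close that unfolding close_roots_def by (metis Suc_eq_plus1 Suc_less_eq less_le_trans)
  have qp: "i < roots_ge t p" if "Suc i < roots_ge t q" for i t
    using close that unfolding close_roots_def by (metis Suc_eq_plus1 Suc_less_eq less_le_trans)
  obtain b0 where b0: "\<And>t. t \<le> b0 \<Longrightarrow> 0 < (- 1) ^ m * poly (p + q) t"
    using poly_sign_at_bot[OF lc] degpq by metis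
  \<comment> \<open>\<open>b\<close> lies left of all roots, where the sign of \<open>p + q\<close>
    is already that at minus infinity. It replaces the missing last root of \<open>q\<close> when
    \<open>k + 1 = m\<close>.\<close>
  define b where "b = Min (insert b0 (v ` {..<m} \<union> w ` {..<k})) - 1"
  have bb: "b \<le> b0" and bv: "\<And>i. i < m \<Longrightarrow> b < v i" and bw: "\<And>i. i < k \<Longrightarrow> b < w i"
  proof -
    have fin: "finite (insert b0 (v ` {..<m} \<union> w ` {..<k}))" by simp
    have "b + 1 \<le> x" if "x \<in> insert b0 (v ` {..<m} \<union> w ` {..<k})" for x
      unfolding b_def using Min_le[OF fin that] by simp
    note le = this
    show "b \<le> b0" using le[of b0] by simp
    show "b < v i" if "i < m" for i using le[of "v i"] that by simp
    show "b < w i" if "i < k" for i using le[of "w i"] that by simp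
  qed
  define W where "W = (\<lambda>i. if i < k then w i else b)"
  define lo hi where "lo = (\<lambda>i. min (v i) (W i))" and "hi = (\<lambda>i. max (v i) (W i))"
  have ne: "v i \<noteq> W i" if "i < m" for i
    using disj[OF v0[OF that]] w0[of i] bv[OF that] by (auto simp: W_def)
  \<comment> \<open>At a root of one polynomial the sum equals the other one, whose sign is given by
    its root count.\<close>
  have sgn_p: "0 < (- 1) ^ roots_ge t q * poly (p + q) t" if "poly p t = 0" for t
    using real_split_sign[OF q disj[OF that]] that by simp
  have sgn_q: "0 < (- 1) ^ roots_ge t p * poly (p + q) t" if "poly q t = 0" for t
    using real_split_sign[OF p] disj that by fastforce
  \<comment> \<open>At the larger of the two roots with index \<open>i\<close>, the other polynomial
    has exactly \<open>i\<close> roots at or beyond it.\<close>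
  have shi: "0 < (- 1) ^ i * poly (p + q) (hi i)" if i: "i < m" for i
  proof (cases "W i < v i")
    case True
    then have h: "hi i = v i" by (simp add: hi_def)
    have "\<not> i < roots_ge (v i) q" using True by (auto simp: w W_def)
    moreover have "i \<le> roots_ge (v i) q"
      using pq[of "i - 1" "v i"] v[of i "v i"] i by (cases i) auto
    ultimately have "roots_ge (v i) q = i" by simp
    then show ?thesis using sgn_p[OF v0[OF i]] h by simp
  next
    case False
    then have less: "v i < W i" using ne[OF i] by simp
    then have ik: "i < k" using bv[OF i] by (auto simp: W_def split: if_splits)
    then have h: "hi i = w i" using less by (simp add: hi_def W_def)
    have "\<not> i < roots_ge (w i) p" using less ik by (auto simp: v W_def)
    moreover have "i \<le> roots_ge (w i) p"
      using qp[of "i - 1" "w i"] w[of i "w i"] ik by (cases i) auto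
    ultimately have "roots_ge (w i) p = i" by simp
    then show ?thesis using sgn_q[OF w0[OF ik]] h by simp
  qed
  \<comment> \<open>At the smaller one, the other polynomial has exactly \<open>Suc i\<close> roots
    at or beyond it, unless the smaller one is the artificial point \<open>b\<close>.\<close>
  have slo: "0 < (- 1) ^ Suc i * poly (p + q) (lo i)" if i: "i < m" for i
  proof (cases "v i < W i")
    case True
    then have ik: "i < k" using bv[OF i] by (auto simp: W_def split: if_splits)
    have l: "lo i = v i" using True by (simp add: lo_def)
    have "i < roots_ge (v i) q" using True ik by (simp add: w W_def)
    moreover have "\<not> Suc i < roots_ge (v i) q"
    proof
      assume a: "Suc i < roots_ge (v i) q"
      then have "Suc i < k" "v i \<le> w (Suc i)" by (auto simp: w)
      moreover have "v i \<noteq> w (Suc i)" using disj[OF v0[OF i]] w0[OF \<open>Suc i < k\<close>] by auto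
      \<comment> \<open>Closeness is tested at \<open>w (Suc i)\<close>, strictly right of
        \<open>v i\<close>: there it would demand \<open>w (Suc i) \<le> v i\<close>.\<close>
      ultimately have "Suc i < roots_ge (w (Suc i)) q" "v i < w (Suc i)" by (auto simp: w)
      then show False using qp[of i "w (Suc i)"] by (auto simp: v)
    qed
    ultimately have "roots_ge (v i) q = Suc i" by simp
    then show ?thesis using sgn_p[OF v0[OF i]] l by simp
  next
    case False
    then have less: "W i < v i" using ne[OF i] by simp
    show ?thesis
    proof (cases "i < k")
      case ik: True
      have l: "lo i = w i" using less ik by (simp add: lo_def W_def)
      have "i < roots_ge (w i) p" using less ik i by (simp add: v W_def)
      moreover have "\<not> Suc i < roots_ge (w i) p"
      proof
        assume a: "Suc i < roots_ge (w i) p"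
        then have "Suc i < m" "w i \<le> v (Suc i)" by (auto simp: v)
        moreover have "w i \<noteq> v (Suc i)" using disj[OF v0[OF \<open>Suc i < m\<close>]] w0[OF ik] by auto
        ultimately have "Suc i < roots_ge (v (Suc i)) p" "w i < v (Suc i)" by (auto simp: v)
        then show False using pq[of i "v (Suc i)"] by (auto simp: w)
      qed
      ultimately have "roots_ge (w i) p = Suc i" by simp
      then show ?thesis using sgn_q[OF w0[OF ik]] l by simp
    next
      case False
      then have "Suc i = m" "lo i = b" using km i less by (auto simp: lo_def W_def)
      then show ?thesis using b0[OF bb] by simp
    qed
  qed
  \<comment> \<open>Closeness puts both roots with index \<open>Suc i\<close> at or below both roots
    with index \<open>i\<close>, so consecutive intervals share at most an endpoint.\<close>
  have step: "hi (Suc i) \<le> lo i" if i: "Suc i < m" for i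
  proof -
    have ik: "i < k" using i km by simp
    have "v (Suc i) \<le> v i" using v[of "Suc i" "v (Suc i)"] v[of i "v (Suc i)"] i by auto
    moreover have "v (Suc i) \<le> w i"
      using pq[of i "v (Suc i)"] v[of "Suc i" "v (Suc i)"] i by (auto simp: w)
    moreover have "W (Suc i) \<le> v i"
      using qp[of i "w (Suc i)"] w[of "Suc i" "w (Suc i)"] bv[of i] i by (auto simp: v W_def)
    moreover have "W (Suc i) \<le> w i"
      using w[of "Suc i" "w (Suc i)"] w[of i "w (Suc i)"] bw[OF ik] by (auto simp: W_def)
    ultimately show ?thesis using ik by (simp add: hi_def lo_def W_def)
  qed
  have "\<exists>u. lo i < u \<and> u < hi i \<and> poly (p + q) u = 0" if i: "i < m" for i
  proof -
    have "lo i < hi i" using ne[OF i] by (auto simp: lo_def hi_def)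
    moreover have "poly (p + q) (lo i) * poly (p + q) (hi i) < 0"
      using slo[OF i] shi[OF i] by (cases "even i") (auto simp: mult_less_0_iff)
    ultimately show ?thesis using poly_IVT by blast
  qed
  then obtain u where u: "\<And>i. i < m \<Longrightarrow> lo i < u i \<and> u i < hi i \<and> poly (p + q) (u i) = 0"
    by metis
  have dec: "u j < u i" if "i < j" "j < m" for i j
    using that
  proof (induction j)
    case (Suc j)
    then have "u (Suc j) < u j" using step[of j] u[of j] u[of "Suc j"] by force
    then show ?case using Suc by (cases "i = j") auto
  qed simp
  have inj: "inj_on u {..<m}"
    by (rule inj_onI) (metis dec lessThan_iff less_irrefl nat_neq_iff)
  have nz: "p + q \<noteq> 0" using lc by (metis coeff_0 less_irrefl)
  \<comment> \<open>The \<open>m\<close> distinct points \<open>u i\<close> are roots of a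
    polynomial of degree \<open>m\<close>; hence they are all its roots, and simple.\<close>
  have sub: "mset_set (u ` {..<m}) \<subseteq># proots (p + q)"
  proof (rule mset_subset_eqI)
    fix x
    show "count (mset_set (u ` {..<m})) x \<le> count (proots (p + q)) x"
    proof (cases "x \<in> u ` {..<m}")
      case True
      then have "0 < count (proots (p + q)) x"
        using u nz by (auto simp: order_gt_0_iff)
      then show ?thesis by (simp add: count_mset_set')
    qed (simp add: count_mset_set')
  qed
  have "size (mset_set (u ` {..<m})) = m" using inj by (simp add: card_image)
  then have roots: "proots (p + q) = mset_set (u ` {..<m})"
    using sub size_proots_le[of "p + q"] degpq
    by (metis mset_subset_size not_le subset_mset.le_imp_less_or_eq)
  have split: "real_split (p + q)"
    using lc roots degpq inj by (intro real_splitI_size) (auto simp: card_image)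
  have cnt: "roots_ge t (p + q) = card {i. i < m \<and> t \<le> u i}" for t
  proof -
    have "roots_ge t (p + q) = card {x \<in> u ` {..<m}. t \<le> x}"
      by (simp add: roots_ge_def roots)
    also have "{x \<in> u ` {..<m}. t \<le> x} = u ` {i. i < m \<and> t \<le> u i}" by auto
    also have "card \<dots> = card {i. i < m \<and> t \<le> u i}"
      by (rule card_image) (use inj in \<open>auto simp: inj_on_def\<close>)
    finally show ?thesis .
  qed
  have dec': "u j \<le> u i" if "i \<le> j" "j < m" for i j
    using dec[of i j] that by (cases "i = j") auto
  have idx: "i < roots_ge t (p + q)" if "i < m" "t \<le> u i" for i t
  proof -
    have "{..i} \<subseteq> {i. i < m \<and> t \<le> u i}" using that dec' by fastforce
    from card_mono[OF _ this] show ?thesis by (simp add: cnt)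
  qed
  have idx': "i < m \<and> t \<le> u i" if "i < roots_ge t (p + q)" for i t
  proof (rule ccontr)
    assume "\<not> ?thesis"
    then have "{i. i < m \<and> t \<le> u i} \<subseteq> {..<i}"
      using dec'[of i] by (auto simp flip: not_le) (metis le_less_trans order_trans)
    from card_mono[OF _ this] show False using that by (simp add: cnt)
  qed
  have "min (roots_ge t p) (roots_ge t q) \<le> roots_ge t (p + q)" for t
  proof (rule ccontr)
    define i where "i = roots_ge t (p + q)"
    assume "\<not> ?thesis"
    then have "i < roots_ge t p" "i < roots_ge t q" by (auto simp: i_def)
    then have "i < m" "t \<le> lo i" by (auto simp: v w lo_def W_def)
    then have "i < roots_ge t (p + q)" using u[of i] by (intro idx) auto
    then show False by (simp add: i_def)
  qed
  moreover have "roots_ge t (p + q) \<le> max (roots_ge t p) (roots_ge t q)" for t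
  proof (rule ccontr)
    define i where "i = max (roots_ge t p) (roots_ge t q)"
    assume "\<not> ?thesis"
    then have "i < roots_ge t (p + q)" by (simp only: i_def not_le)
    then have i: "i < m" "t \<le> u i" using idx' by auto
    then have "t \<le> hi i" using u[of i] by auto
    moreover have "\<not> i < roots_ge t p" "\<not> i < roots_ge t q" by (auto simp: i_def)
    \<comment> \<open>Neither polynomial has its root with index \<open>i\<close> at or beyond
      \<open>t\<close>, so \<open>hi i\<close> could only be the artificial point \<open>b\<close>,
      which is left of \<open>v i\<close>.\<close>
    ultimately have "i \<ge> k" "t \<le> b" using i
      by (auto simp: v w hi_def W_def max_def split: if_splits)
    then show False using bv[OF i(1)] \<open>\<not> i < roots_ge t p\<close> i by (auto simp: v)
  qed
  ultimately show ?thesis using split by blast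
qed

text \<open>Cancel common roots by induction on the degree: a common factor changes both counts by
  the same amount, so closeness and the bounds persist.\<close>

lemma real_split_add:
  assumes "real_split p" "real_split q" "close_roots p q"
  shows "real_split (p + q)"
    and "min (roots_ge t p) (roots_ge t q) \<le> roots_ge t (p + q)"
    and "roots_ge t (p + q) \<le> max (roots_ge t p) (roots_ge t q)"
proof -
  have "real_split (p + q)
    \<and> (\<forall>t. min (roots_ge t p) (roots_ge t q) \<le> roots_ge t (p + q)
         \<and> roots_ge t (p + q) \<le> max (roots_ge t p) (roots_ge t q))"
    using assms
  proof (induction "degree p" arbitrary: p q rule: less_induct)
    case less
    show ?case
    proof (cases "\<exists>x. poly p x = 0 \<and> poly q x = 0")
      case True
      then obtain x where x: "poly p x = 0" "poly q x = 0" by blast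
      obtain p' where p': "p = [:- x, 1:] * p'" "real_split p'"
        using real_split_root[OF less.prems(1) x(1)] .
      obtain q' where q': "q = [:- x, 1:] * q'" "real_split q'"
        using real_split_root[OF less.prems(2) x(2)] .
      have "degree p' < degree p"
        unfolding p'(1) by (simp only: degree_linear_mult[OF real_split_nonzero[OF p'(2)]])
      moreover have "close_roots p' q'"
        using less.prems(3) unfolding close_roots_def p'(1) q'(1)
        by (simp add: roots_ge_linear p'(2) q'(2) del: mult_pCons_left)
      ultimately have IH: "real_split (p' + q')
          \<and> (\<forall>t. min (roots_ge t p') (roots_ge t q') \<le> roots_ge t (p' + q')
             \<and> roots_ge t (p' + q') \<le> max (roots_ge t p') (roots_ge t q'))"
        using less.hyps[of p' q'] p'(2) q'(2) by blast
      have eq: "p + q = [:- x, 1:] * (p' + q')"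
        unfolding p'(1) q'(1) by (rule distrib_left[symmetric])
      have "min (roots_ge t p) (roots_ge t q) \<le> roots_ge t (p + q)
          \<and> roots_ge t (p + q) \<le> max (roots_ge t p) (roots_ge t q)" for t
        unfolding eq unfolding p'(1) q'(1)
          roots_ge_linear[OF p'(2)] roots_ge_linear[OF q'(2)] roots_ge_linear[OF conjunct1[OF IH]]
        using IH by (auto simp: min_def max_def split: if_splits)
      then show ?thesis
        unfolding eq using real_split.linear[OF conjunct1[OF IH]] by blast
    next
      case False
      then show ?thesis
        using add_without_common_root[OF less.prems]
          add_without_common_root[OF less.prems(2,1) close_roots_sym[OF less.prems(3)]]
        by (cases "degree q \<le> degree p") (auto simp: add.commute min.commute max.commute)
    qed
  qed
  then show "real_split (p + q)"
    and "min (roots_ge t p) (roots_ge t q) \<le> roots_ge t (p + q)"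
    and "roots_ge t (p + q) \<le> max (roots_ge t p) (roots_ge t q)" by blast+
qed

section \<open>Polynomials with only nonpositive roots\<close>

text \<open>Nonpositivity is phrased through counts so that any upper bound on counts transfers
  it.\<close>

definition nonpos_split :: "real poly \<Rightarrow> bool" where
  "nonpos_split p \<longleftrightarrow> real_split p \<and> (\<forall>t>0. roots_ge t p = 0)"

lemma nonpos_split_const: "0 < c \<Longrightarrow> nonpos_split [:c:]"
  by (simp add: nonpos_split_def real_split.const)

lemma nonpos_split_linear:
  "nonpos_split p \<Longrightarrow> v \<le> 0 \<Longrightarrow> nonpos_split ([:- v, 1:] * p)"
  unfolding nonpos_split_def by (auto simp only: roots_ge_linear intro: real_split.linear) auto

lemma nonpos_split_linearD:
  "nonpos_split ([:- v, 1:] * p) \<Longrightarrow> real_split p \<Longrightarrow> nonpos_split p \<and> v \<le> 0"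
  unfolding nonpos_split_def
  by (auto simp: roots_ge_linear not_le simp del: mult_pCons_left) (meson less_irrefl not_le)

lemma nonpos_split_induct [consumes 1, case_names const linear]:
  assumes "nonpos_split p"
    and "\<And>c. 0 < c \<Longrightarrow> P [:c:]"
    and "\<And>p v. nonpos_split p \<Longrightarrow> v \<le> 0 \<Longrightarrow> P p \<Longrightarrow> P ([:- v, 1:] * p)"
  shows "P p"
proof -
  have "real_split p" using assms(1) by (simp add: nonpos_split_def)
  then show ?thesis using assms(1)
  proof (induction rule: real_split.induct)
    case (const c)
    then show ?case using assms(2) by blast
  next
    case (linear p v)
    then show ?case using nonpos_split_linearD assms(3) by blast
  qed
qed

lemma nonpos_splitD: "nonpos_split p \<Longrightarrow> real_split p" "nonpos_split p \<Longrightarrow> p \<noteq> 0"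
  by (auto simp: nonpos_split_def dest: real_split_nonzero)

lemma nonpos_splitI:
  "real_split p \<Longrightarrow> (\<And>t. 0 < t \<Longrightarrow> roots_ge t p \<le> roots_ge t q) \<Longrightarrow> nonpos_split q \<Longrightarrow> nonpos_split p"
  by (simp add: nonpos_split_def)

lemma nonpos_split_add:
  assumes "nonpos_split p" "nonpos_split q" "close_roots p q"
  shows "nonpos_split (p + q)"
  using assms real_split_add[of p q] unfolding nonpos_split_def
  by (metis le_zero_eq max.idem)

section \<open>The operator behind \<open>T_op\<close> and \<open>U_op\<close>\<close>

text \<open>Up to the factor \<open>(1 - x) ^ (n + 1)\<close>, this is the derivative of
  \<open>g / (1 - x) ^ n\<close>; it is the polar derivative with pole 1. The parameter is real so
  that \<open>n - 1\<close> is true subtraction.\<close>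

definition L_op :: "real \<Rightarrow> real poly \<Rightarrow> real poly" where
  "L_op n g = smult n g + [:1, - 1:] * pderiv g"

lemma T_op_eq_L_op: "T_op n f = L_op (real n) ([:0, 1:] * f)"
  by (simp add: T_op_def L_op_def pderiv_mult pderiv_pCons algebra_simps smult_diff_left)

lemma U_op_eq_L_op: "U_op (Suc n) f = [:0, 1:] * L_op (real n) f"
  by (simp add: U_op_def L_op_def algebra_simps)

lemma L_op_succ: "L_op n g = L_op (n - 1) g + g"
  by (simp add: L_op_def algebra_simps smult_diff_left)

lemma poly_L_op: "poly (L_op n g) x = n * poly g x + (1 - x) * poly (pderiv g) x"
  by (simp add: L_op_def algebra_simps)

lemma poly_pderiv_linear_mult:
  fixes g :: "real poly"
  shows "poly (pderiv ([:- v, 1:] * g)) x = poly g x + (x - v) * poly (pderiv g) x"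
  unfolding pderiv_mult by (simp add: pderiv_pCons algebra_simps)

text \<open>In the term \<open>(1 - x) * g\<close> from the product rule write 1 - x = (1 - v) - (x
  - v). For \<open>v \<le> 0\<close> the coefficient \<open>1 - v\<close> is positive.\<close>

lemma L_op_linear_mult: "L_op n ([:- v, 1:] * g) = [:- v, 1:] * L_op (n - 1) g + smult (1 - v) g"
  by (rule poly_eq_poly_eq_iff[THEN iffD1], rule ext)
    (simp only: poly_L_op poly_pderiv_linear_mult poly_add poly_mult poly_smult, simp add: algebra_simps)

text \<open>Splitting off an artificial root at \<open>1\<close>, where \<open>1 - x\<close> vanishes, makes the two
  summands differ by at most one root on the nonpositive half-line, wherever the root \<open>v\<close> of the
  factor lies.\<close>

lemma L_op_linear_mult_at_1: "L_op n ([:- v, 1:] * g) = [:- 1, 1:] * L_op (n - 1) g + smult (1 - v) (L_op n g)"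
  by (rule poly_eq_poly_eq_iff[THEN iffD1], rule ext)
    (simp only: poly_L_op poly_pderiv_linear_mult poly_add poly_mult poly_smult, simp add: algebra_simps)

lemma L_op_root_shift: "L_op n ([:- v, 1:] * g) = L_op n ([:- w, 1:] * g) + smult (w - v) (L_op n g)"
  by (rule poly_eq_poly_eq_iff[THEN iffD1], rule ext)
    (simp only: poly_L_op poly_pderiv_linear_mult poly_add poly_mult poly_smult, simp add: algebra_simps)

text \<open>Induct over the roots with \<open>L_op_linear_mult\<close>: the induction hypothesis
  makes the two summands close. The parameter drops together with the degree, so it is still
  positive when only a constant is left.\<close>

lemma L_op_nonpos_split:
  assumes "nonpos_split g" "real (degree g) < n"
  shows "nonpos_split (L_op n g)" and "roots_ge t (L_op n g) \<le> roots_ge t g"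
    and "roots_ge t g \<le> roots_ge t (L_op n g) + 1"
proof -
  have "nonpos_split (L_op n g) \<and>
      (\<forall>t. roots_ge t (L_op n g) \<le> roots_ge t g \<and> roots_ge t g \<le> roots_ge t (L_op n g) + 1)"
    using assms
  proof (induction arbitrary: n rule: nonpos_split_induct)
    case (const c)
    then show ?case using nonpos_split_const[of "n * c"] by (simp add: L_op_def pderiv_pCons)
  next
    case (linear g v)
    note g = nonpos_splitD[OF linear.hyps(1)]
    have "real (degree g) < n - 1"
      using linear.prems degree_linear_mult[OF g(2), of v] by simp
    note IH = linear.IH[OF this]
    let ?p = "[:- v, 1:] * L_op (n - 1) g" and ?q = "smult (1 - v) g"
    have Ls: "real_split (L_op (n - 1) g)" using IH nonpos_splitD by blast
    have p: "roots_ge t ?p = of_bool (t \<le> v) + roots_ge t (L_op (n - 1) g)" for t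
      by (rule roots_ge_linear[OF Ls])
    have q: "roots_ge t ?q = roots_ge t g" for t
      using linear.hyps by (simp add: roots_ge_smult)
    have rp: "real_split ?p" by (rule real_split.linear[OF Ls])
    have rq: "real_split ?q" using g linear.hyps by (intro real_split_smult) auto
    have close: "close_roots ?p ?q"
      unfolding close_roots_def p q
    proof
      fix t
      show "of_bool (t \<le> v) + roots_ge t (L_op (n - 1) g) \<le> roots_ge t g + 1
          \<and> roots_ge t g \<le> of_bool (t \<le> v) + roots_ge t (L_op (n - 1) g) + 1"
        using IH[THEN conjunct2, rule_format, of t] by (cases "t \<le> v") auto
    qed
    have rg: "roots_ge t ([:- v, 1:] * g) = of_bool (t \<le> v) + roots_ge t g" for t
      by (rule roots_ge_linear[OF g(1)])
    have 1: "roots_ge t (L_op n ([:- v, 1:] * g)) \<le> roots_ge t ([:- v, 1:] * g)"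
     and 2: "roots_ge t ([:- v, 1:] * g) \<le> roots_ge t (L_op n ([:- v, 1:] * g)) + 1" for t
      unfolding L_op_linear_mult[of n v g]
      using real_split_add(2,3)[OF rp rq close, of t] IH[THEN conjunct2, rule_format, of t]
      unfolding p q rg by (auto simp: max_def min_def split: if_splits)
    have "real_split (L_op n ([:- v, 1:] * g))"
      unfolding L_op_linear_mult[of n v g] by (rule real_split_add(1)[OF rp rq close])
    then show ?case
      using 1 2 nonpos_split_linear[OF linear.hyps(1,2)] nonpos_splitI by blast
  qed
  then show "nonpos_split (L_op n g)" and "roots_ge t (L_op n g) \<le> roots_ge t g"
    and "roots_ge t g \<le> roots_ge t (L_op n g) + 1" by blast+
qed

section \<open>Monotonicity of \<open>L_op\<close> in the root counts\<close>

lemma nonpos_split_mult: "nonpos_split p \<Longrightarrow> nonpos_split q \<Longrightarrow> nonpos_split (p * q)"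
  by (simp add: nonpos_split_def real_split_mult roots_ge_mult real_split_nonzero)

text \<open>By \<open>L_op_succ\<close> the counts of \<open>L_op n g\<close> lie between those of
  \<open>L_op (n - 1) g\<close> and \<open>g\<close>, which are at most one apart. Hence the two
  summands in \<open>L_op_linear_mult_at_1\<close> are close, the first having the larger
  counts.\<close>

lemma L_op_linear_bounds:
  assumes g: "nonpos_split g" and deg: "real (degree g) + 1 < n" and v: "v \<le> 0"
  shows "roots_ge t (L_op n g) \<le> roots_ge t (L_op n ([:- v, 1:] * g))"
    and "roots_ge t (L_op n ([:- v, 1:] * g)) \<le> roots_ge t (L_op n g) + 1"
proof -
  have A: "nonpos_split (L_op (n - 1) g)" "nonpos_split (L_op n g)"
    using deg by (auto intro: L_op_nonpos_split g)
  note As = A[THEN nonpos_splitD(1)]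
  have ac: "roots_ge t (L_op (n - 1) g) \<le> roots_ge t g"
    "roots_ge t g \<le> roots_ge t (L_op (n - 1) g) + 1" for t
    using deg L_op_nonpos_split(2,3)[OF g, of "n - 1" t] by auto
  have "close_roots (L_op (n - 1) g) g"
    unfolding close_roots_def using ac by (simp add: le_SucI)
  from real_split_add(2,3)[OF As(1) nonpos_splitD(1)[OF g] this]
  have bc: "roots_ge t (L_op (n - 1) g) \<le> roots_ge t (L_op n g)" "roots_ge t (L_op n g) \<le> roots_ge t g" for t
    unfolding L_op_succ[of n g, symmetric] using ac(1)[of t] by (metis min.absorb1, metis max.absorb2)
  let ?p = "[:- 1, 1:] * L_op (n - 1) g" and ?q = "smult (1 - v) (L_op n g)"
  have p: "roots_ge t ?p = of_bool (t \<le> 1) + roots_ge t (L_op (n - 1) g)" for t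
    by (rule roots_ge_linear[OF As(1)])
  have q: "roots_ge t ?q = roots_ge t (L_op n g)" for t
    using v by (simp add: roots_ge_smult)
  \<comment> \<open>Beyond 1 the artificial root is no longer counted, but there all counts
    vanish.\<close>
  have far: "roots_ge t (L_op n g) = 0" if "\<not> t \<le> 1" for t
    using A(2) that by (simp add: nonpos_split_def)
  have rp: "real_split ?p" by (rule real_split.linear[OF As(1)])
  have rq: "real_split ?q" using As(2) v by (intro real_split_smult) auto
  have pq: "roots_ge t ?q \<le> roots_ge t ?p" "roots_ge t ?p \<le> roots_ge t ?q + 1" for t
    unfolding p q using ac[of t] bc[of t] far[of t] by (cases "t \<le> 1"; simp)+
  have "close_roots ?p ?q"
    unfolding close_roots_def using pq by (meson le_add1 order_trans)
  from real_split_add(2,3)[OF rp rq this, of t] pq[of t]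
  show "roots_ge t (L_op n g) \<le> roots_ge t (L_op n ([:- v, 1:] * g))"
    and "roots_ge t (L_op n ([:- v, 1:] * g)) \<le> roots_ge t (L_op n g) + 1"
    unfolding L_op_linear_mult_at_1[of n v g, symmetric] q by (simp_all only: min_def max_def split: if_splits)
qed

text \<open>In \<open>L_op_root_shift\<close> the summand \<open>smult (w - v) (L_op n g)\<close>
  has the smaller counts, so the maximum bounding the sum is attained by the other summand. For
  \<open>v = w\<close> it vanishes.\<close>

lemma L_op_root_shift_mono:
  assumes g: "nonpos_split g" and deg: "real (degree g) + 1 < n" and vw: "v \<le> w" "w \<le> 0"
  shows "roots_ge t (L_op n ([:- v, 1:] * g)) \<le> roots_ge t (L_op n ([:- w, 1:] * g))"
proof (cases "v = w")
  case False
  let ?p = "L_op n ([:- w, 1:] * g)" and ?q = "smult (w - v) (L_op n g)"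
  have dw: "real (degree ([:- w, 1:] * g)) < n"
    using deg degree_linear_mult[OF nonpos_splitD(2)[OF g], of w] by simp
  have q: "roots_ge t ?q = roots_ge t (L_op n g)" for t
    using False by (simp add: roots_ge_smult)
  have rp: "real_split ?p"
    using L_op_nonpos_split(1)[OF nonpos_split_linear[OF g vw(2)] dw] nonpos_splitD by blast
  have rq: "real_split ?q"
    using L_op_nonpos_split(1)[OF g] deg False vw by (intro real_split_smult nonpos_splitD) auto
  note b = L_op_linear_bounds[OF g deg vw(2)]
  have "close_roots ?p ?q"
    unfolding close_roots_def q using b by (meson le_add1 order_trans)
  from real_split_add(3)[OF rp rq this, of t] b(1)[of t] show ?thesis
    unfolding L_op_root_shift[of n v g w, symmetric] q by simp
qed simp

lemma L_op_mult_ge: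
  assumes "nonpos_split g" "nonpos_split k" "real (degree (k * g)) < n"
  shows "roots_ge t (L_op n k) \<le> roots_ge t (L_op n (k * g))"
  using assms
proof (induction rule: nonpos_split_induct)
  case (const c)
  then have "L_op n (k * [:c:]) = smult c (L_op n k)"
    by (simp add: L_op_def pderiv_smult smult_add_right mult.commute)
  then show ?case using const by (simp add: roots_ge_smult)
next
  case (linear g v)
  have kg: "nonpos_split (k * g)" using linear nonpos_split_mult by blast
  have eq: "k * ([:- v, 1:] * g) = [:- v, 1:] * (k * g)" by (simp only: mult.left_commute)
  have "real (degree (k * g)) + 1 < n"
    using linear.prems(2) unfolding eq degree_linear_mult[OF nonpos_splitD(2)[OF kg]] by simp
  then show ?case
    unfolding eq using linear L_op_linear_bounds(1)[OF kg _ linear.hyps(2)]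
    by (meson le_trans less_trans less_add_one)
qed

lemma real_split_max_root:
  assumes "real_split p" "0 < degree p"
  obtains z q where "p = [:- z, 1:] * q" "real_split q" "\<And>t. z < t \<Longrightarrow> roots_ge t p = 0"
proof -
  obtain v where v: "\<And>i t. i < roots_ge t p \<longleftrightarrow> i < degree p \<and> t \<le> v i"
    and v0: "\<And>i. i < degree p \<Longrightarrow> poly p (v i) = 0"
    using real_split_root_seq[OF assms(1)] by metis
  obtain q where "p = [:- v 0, 1:] * q" "real_split q"
    using real_split_root[OF assms(1) v0[OF assms(2)]] .
  moreover have "roots_ge t p = 0" if "v 0 < t" for t
    using v[of 0 t] that by auto
  ultimately show ?thesis using that by blast
qed

text \<open>Move the largest root of \<open>f\<close> right to the largest root of \<open>g\<close>,
  then absorb this now common root into \<open>k\<close> and continue with the rest. The factor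
  \<open>k\<close> collects the matched roots; the roots of \<open>g\<close> left over at the end
  only raise the count.\<close>

lemma L_op_mono:
  assumes "nonpos_split f" "nonpos_split g" "nonpos_split k"
    and "\<And>t. roots_ge t f \<le> roots_ge t g" and "real (degree (k * g)) < n"
  shows "roots_ge t (L_op n (k * f)) \<le> roots_ge t (L_op n (k * g))"
  using assms
proof (induction "degree f" arbitrary: f g k)
  case 0
  then obtain c where c: "f = [:c:]" by (metis degree_eq_zeroE)
  then have "c \<noteq> 0" using nonpos_splitD(2)[OF 0(2)] by auto
  moreover have "L_op n (k * f) = smult c (L_op n k)"
    by (simp add: c L_op_def pderiv_smult smult_add_right mult.commute)
  ultimately show ?case using L_op_mult_ge[OF 0(3,4,6)] by (simp add: roots_ge_smult)
next
  case (Suc d)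
  note fs = nonpos_splitD(1)[OF Suc.prems(1)] and gs = nonpos_splitD(1)[OF Suc.prems(2)]
  have dfg: "degree f \<le> degree g"
    using degree_le_of_roots_ge[OF fs gs, of 0] Suc.prems(4) by simp
  obtain z f' where f': "f = [:- z, 1:] * f'" "real_split f'" "\<And>t. z < t \<Longrightarrow> roots_ge t f = 0"
    using real_split_max_root[OF fs] Suc.hyps(2) by auto
  obtain w g' where g': "g = [:- w, 1:] * g'" "real_split g'" "\<And>t. w < t \<Longrightarrow> roots_ge t g = 0"
    using real_split_max_root[OF gs] Suc.hyps(2) dfg by auto
  have rf: "roots_ge t f = of_bool (t \<le> z) + roots_ge t f'" for t
    unfolding f'(1) by (rule roots_ge_linear[OF f'(2)])
  have rg: "roots_ge t g = of_bool (t \<le> w) + roots_ge t g'" for t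
    unfolding g'(1) by (rule roots_ge_linear[OF g'(2)])
  have zw: "z \<le> w"
    using Suc.prems(4)[of z] g'(3)[of z] rf[of z] by (cases "z \<le> w") auto
  \<comment> \<open>Up to \<open>z\<close> both counts drop by one; beyond \<open>z\<close> the
    polynomial \<open>f\<close> has no roots.\<close>
  have le: "roots_ge t f' \<le> roots_ge t g'" for t
    using Suc.prems(4)[of t] f'(3)[of t] rf[of t] rg[of t] zw by (cases "t \<le> z") auto
  have f'n: "nonpos_split f'" and g'n: "nonpos_split g'" and w0: "w \<le> 0"
    using Suc.prems(1,2) nonpos_split_linearD f'(1,2) g'(1,2) by blast+
  have kf': "nonpos_split (k * f')" using Suc.prems(3) f'n by (rule nonpos_split_mult)
  have df': "degree f = Suc (degree f')"
    unfolding f'(1) by (rule degree_linear_mult[OF nonpos_splitD(2)[OF f'n]])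
  have "real (degree (k * f')) + 1 < n"
    using Suc.prems(5) dfg df' Suc.prems(1-3) f'n
    by (auto simp: degree_mult_eq nonpos_splitD(2))
  then have "roots_ge t (L_op n ([:- z, 1:] * (k * f'))) \<le> roots_ge t (L_op n ([:- w, 1:] * (k * f')))"
    by (rule L_op_root_shift_mono[OF kf' _ zw w0])
  moreover have "roots_ge t (L_op n (([:- w, 1:] * k) * f')) \<le> roots_ge t (L_op n (([:- w, 1:] * k) * g'))"
  proof (rule Suc.hyps(1)[OF _ f'n g'n _ le])
    show "d = degree f'" using Suc.hyps(2) df' by simp
    show "nonpos_split ([:- w, 1:] * k)" by (rule nonpos_split_linear[OF Suc.prems(3) w0])
    show "real (degree ([:- w, 1:] * k * g')) < n"
      using Suc.prems(5) unfolding g'(1) by (simp only: mult.assoc mult.left_commute)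
  qed
  ultimately show ?case
    unfolding f'(1) g'(1) by (simp only: mult.assoc mult.left_commute)
qed

section \<open>Closeness of the images under \<open>T_op\<close> and \<open>U_op\<close>\<close>

lemma roots_ge_X_mult: "real_split p \<Longrightarrow> roots_ge t ([:0, 1:] * p) = of_bool (t \<le> 0) + roots_ge t p"
  using roots_ge_linear[of p t 0] by simp

lemma close_roots_L_op:
  assumes f: "nonpos_split f" and g: "nonpos_split g" and close: "close_roots f g"
    and degf: "real (degree f) + 1 < n" and degg: "real (degree g) < n"
  shows "close_roots (L_op n ([:0, 1:] * f)) ([:0, 1:] * L_op n g)"
proof -
  note fs = nonpos_splitD(1)[OF f] and gs = nonpos_splitD(1)[OF g]
  have xf: "nonpos_split ([:0, 1:] * f)" using nonpos_split_linear[OF f, of 0] by simp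
  have dxf: "real (degree ([:0, 1:] * f)) < n"
    using degf degree_linear_mult[OF nonpos_splitD(2)[OF f], of 0] by simp
  have rX: "roots_ge t ([:0, 1:] * L_op n g) = of_bool (t \<le> 0) + roots_ge t (L_op n g)" for t
    using L_op_nonpos_split(1)[OF g degg] nonpos_splitD by (intro roots_ge_X_mult) blast
  have far: "roots_ge t p = 0" if "nonpos_split p" "\<not> t \<le> 0" for t p
    using that by (simp add: nonpos_split_def)
  have "roots_ge t g \<le> roots_ge t ([:0, 1:] * f)" for t
    unfolding roots_ge_X_mult[OF fs] using close far[OF g, of t]
    by (cases "t \<le> 0") (auto simp: close_roots_def)
  from L_op_mono[OF g xf nonpos_split_const[of 1] this, of n] dxf
  have lower: "roots_ge t (L_op n g) \<le> roots_ge t (L_op n ([:0, 1:] * f))" for t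
    by (simp add: one_pCons[symmetric])
  \<comment> \<open>Without its largest root \<open>f\<close> has counts at most those of
    \<open>g\<close>. Restoring that root and adding the root 0 raise the count of the image by at
    most one each.\<close>
  have upper: "roots_ge t (L_op n ([:0, 1:] * f)) \<le> roots_ge t (L_op n g) + 2" for t
  proof (cases "degree f = 0")
    case True
    then obtain c where "f = [:c:]" by (metis degree_eq_zeroE)
    then have "roots_ge t ([:0, 1:] * f) \<le> 1" unfolding roots_ge_X_mult[OF fs] by simp
    then show ?thesis using L_op_nonpos_split(2)[OF xf dxf, of t] by simp
  next
    case False
    then obtain z f' where f': "f = [:- z, 1:] * f'" "real_split f'"
      "\<And>t. z < t \<Longrightarrow> roots_ge t f = 0"
      using real_split_max_root[OF fs] by auto
    have rf: "roots_ge t f = of_bool (t \<le> z) + roots_ge t f'" for t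
      unfolding f'(1) by (rule roots_ge_linear[OF f'(2)])
    have f'n: "nonpos_split f'" "z \<le> 0" using f f' nonpos_split_linearD by blast+
    have df: "degree f = Suc (degree f')"
      unfolding f'(1) by (rule degree_linear_mult[OF nonpos_splitD(2)[OF f'n(1)]])
    have "roots_ge t f' \<le> roots_ge t g" for t
      using rf[of t] f'(3)[of t] close unfolding close_roots_def
      by (cases "t \<le> z") (auto dest: spec[of _ t])
    from L_op_mono[OF f'n(1) g nonpos_split_const[of 1] this, of n t] degg
    have "roots_ge t (L_op n f') \<le> roots_ge t (L_op n g)" by (simp add: one_pCons[symmetric])
    moreover have "roots_ge t (L_op n f) \<le> roots_ge t (L_op n f') + 1"
      unfolding f'(1) by (rule L_op_linear_bounds(2)[OF f'n(1) _ f'n(2)]) (use df degf in simp)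
    moreover have "roots_ge t (L_op n ([:0, 1:] * f)) \<le> roots_ge t (L_op n f) + 1"
      using L_op_linear_bounds(2)[OF f degf, of 0 t] by simp
    ultimately show ?thesis by simp
  qed
  have far': "roots_ge t (L_op n ([:0, 1:] * f)) = 0" if "\<not> t \<le> 0" for t
    using far[OF L_op_nonpos_split(1)[OF xf dxf] that] .
  show ?thesis
    unfolding close_roots_def rX
  proof
    fix t
    show "roots_ge t (L_op n ([:0, 1:] * f)) \<le> of_bool (t \<le> 0) + roots_ge t (L_op n g) + 1
        \<and> of_bool (t \<le> 0) + roots_ge t (L_op n g) \<le> roots_ge t (L_op n ([:0, 1:] * f)) + 1"
      using lower[of t] upper[of t] far'[of t] by (cases "t \<le> 0") auto
  qed
qed

section \<open>Derivatives and addition of constants\<close>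

text \<open>Rolle's theorem with multiplicities, by induction over the roots: in the product rule
  the summands \<open>[:- v, 1:] * pderiv p\<close> and \<open>p\<close> have close counts.\<close>

lemma real_split_pderiv:
  assumes "real_split p" "0 < degree p"
  shows "real_split (pderiv p) \<and>
    (\<forall>t. roots_ge t (pderiv p) \<le> roots_ge t p \<and> roots_ge t p \<le> roots_ge t (pderiv p) + 1)"
  using assms
proof (induction rule: real_split.induct)
  case (linear p v)
  have eq: "pderiv ([:- v, 1:] * p) = [:- v, 1:] * pderiv p + p"
    unfolding pderiv_mult by (simp add: pderiv_pCons)
  have r: "roots_ge t ([:- v, 1:] * p) = of_bool (t \<le> v) + roots_ge t p" for t
    by (rule roots_ge_linear[OF linear.hyps])
  show ?case
  proof (cases "degree p = 0")
    case True
    then obtain c where c: "p = [:c:]" by (metis degree_eq_zeroE)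
    then have "pderiv ([:- v, 1:] * p) = p" unfolding eq by (simp add: pderiv_pCons)
    then show ?thesis unfolding r using linear.hyps by (simp add: c)
  next
    case False
    then have IH: "real_split (pderiv p)"
      "\<And>t. roots_ge t (pderiv p) \<le> roots_ge t p \<and> roots_ge t p \<le> roots_ge t (pderiv p) + 1"
      using linear.IH by auto
    let ?q = "[:- v, 1:] * pderiv p"
    have q: "roots_ge t ?q = of_bool (t \<le> v) + roots_ge t (pderiv p)" for t
      by (rule roots_ge_linear[OF IH(1)])
    have sq: "real_split ?q" by (rule real_split.linear[OF IH(1)])
    have close: "close_roots ?q p"
      unfolding close_roots_def q
    proof
      fix t
      show "of_bool (t \<le> v) + roots_ge t (pderiv p) \<le> roots_ge t p + 1
          \<and> roots_ge t p \<le> of_bool (t \<le> v) + roots_ge t (pderiv p) + 1"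
        using IH(2)[of t] by (cases "t \<le> v") auto
    qed
    have "roots_ge t (?q + p) \<le> of_bool (t \<le> v) + roots_ge t p
        \<and> of_bool (t \<le> v) + roots_ge t p \<le> roots_ge t (?q + p) + 1" for t
      using real_split_add(2,3)[OF sq linear.hyps close, of t] IH(2)[of t] unfolding q
      by (auto simp: min_def max_def split: if_splits)
    then show ?thesis
      unfolding eq r using real_split_add(1)[OF sq linear.hyps close] by blast
  qed
qed simp

text \<open>Both counts equal that of the common derivative or exceed it by one. Constants are
  treated apart, since their derivative 0 is not split.\<close>

lemma close_roots_same_pderiv:
  assumes "real_split p" "real_split q" "pderiv p = pderiv q"
  shows "close_roots p q"
proof (cases "degree p = 0")
  case True
  then have "degree q = 0" using assms(3) by (metis pderiv_eq_0_iff)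
  then obtain c d where "p = [:c:]" "q = [:d:]" using True by (metis degree_eq_zeroE)
  then show ?thesis by (simp add: close_roots_def)
next
  case False
  moreover have "degree q \<noteq> 0" using assms(3) False by (metis pderiv_eq_0_iff)
  ultimately have "roots_ge t (pderiv q) \<le> roots_ge t p \<and> roots_ge t p \<le> roots_ge t (pderiv q) + 1"
    and "roots_ge t (pderiv q) \<le> roots_ge t q \<and> roots_ge t q \<le> roots_ge t (pderiv q) + 1" for t
    using real_split_pderiv[OF assms(1)] real_split_pderiv[OF assms(2)] by (simp_all add: assms(3))
  then show ?thesis
    unfolding close_roots_def by (meson add_le_mono1 order_trans)
qed

section \<open>Complex zeros\<close>

lemma real_split_complex_root:
  assumes "real_split p" "poly (map_poly of_real p) (z::complex) = 0"
  shows "\<exists>v. z = of_real v \<and> poly p v = 0"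
  using assms
proof (induction rule: real_split.induct)
  case (linear p v)
  have "map_poly of_real ([:- v, 1:] * p) = ([:- of_real v, 1:] * map_poly of_real p :: complex poly)"
    by (rule poly_eqI) (simp add: coeff_map_poly coeff_pCons split: nat.splits)
  then have "z = of_real v \<or> poly (map_poly of_real p) z = 0"
    using linear.prems by (auto simp del: mult_pCons_left)
  then show ?case using linear.IH by auto
qed (simp add: map_poly_pCons)

lemma real_split_real_rooted: "real_split p \<Longrightarrow> real_rooted p"
  unfolding real_rooted_def using real_split_complex_root by (metis Reals_of_real)

lemma nonpos_split_complex_root:
  assumes "nonpos_split p" "poly (map_poly of_real p) (z::complex) = 0"
  shows "z \<in> \<real> \<and> Re z \<le> 0"
proof -
  have p: "real_split p" using assms(1) by (rule nonpos_splitD)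
  obtain v where v: "z = of_real v" "poly p v = 0"
    using real_split_complex_root[OF p assms(2)] by blast
  then have "0 < roots_ge v p" using roots_ge_pos_iff[OF p] by blast
  then have "v \<le> 0" using assms(1) unfolding nonpos_split_def by (metis less_irrefl not_le)
  then show ?thesis using v by simp
qed

section \<open>The polynomials \<open>Q_poly\<close> and compatibility\<close>

text \<open>Keeps the degrees below the operator parameters, as the results on \<open>L_op\<close>
  require.\<close>

lemma degree_Q_poly: "degree (Q_poly a r) \<le> r"
proof (induction r)
  case (Suc r)
  have "degree (T_op n f) \<le> Suc (degree f)" for n f
  proof -
    have "degree ([:1, real n - 1:] * f) \<le> Suc (degree f)"
      by (rule order_trans[OF degree_mult_le]) auto
    moreover have "degree ([:0, 1:] * [:1, - 1:] * pderiv f) \<le> Suc (degree f)"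
    proof (cases "degree f = 0")
      case True
      then have "pderiv f = 0" by (simp add: pderiv_eq_0_iff)
      then show ?thesis by simp
    next
      case False
      have "degree ([:0, 1:] * [:1, - 1:] * pderiv f) \<le> 2 + (degree f - 1)"
        by (rule order_trans[OF degree_mult_le]) (auto simp: degree_pderiv)
      then show ?thesis using False by simp
    qed
    ultimately show ?thesis unfolding T_op_def by (rule degree_add_le)
  qed
  from order_trans[OF this] Suc
  have "degree (T_op (a + Suc r + 1) (Q_poly a r)) \<le> Suc r" by (meson Suc_le_mono)
  moreover have "degree ((- 1 :: real poly) ^ Suc r) \<le> Suc r"
    by (rule order_trans[OF degree_power_le]) simp
  ultimately show ?case unfolding Q_poly.simps by (rule degree_add_le)
qed simp

text \<open>Split \<open>T_op n f\<close> as \<open>U_op n f + f\<close> in the recursion and unfold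
  the extra summand \<open>Q_poly a (Suc r)\<close> once more; the two alternating constants
  cancel.\<close>

lemma Q_poly_Suc_Suc:
  "Q_poly a (Suc (Suc r)) = T_op (a + r + 2) (Q_poly a r) + U_op (Suc (a + r + 2)) (Q_poly a (Suc r))"
proof -
  have "T_op n f = U_op n f + f" for n f
    by (simp add: T_op_def U_op_def algebra_simps)
  then show ?thesis by (simp add: numeral_eq_Suc)
qed

text \<open>Positive scaling leaves the counts unchanged, so the sum result applies; if a
  coefficient is zero, a single multiple or 0 remains.\<close>

lemma compatible_pair:
  assumes p: "real_split p" and q: "real_split q" and close: "close_roots p q"
  shows "compatible [p, q]"
  unfolding compatible_def
proof (intro allI impI)
  fix c :: "nat \<Rightarrow> real"
  assume "\<forall>i<length [p, q]. 0 \<le> c i"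
  then have c: "0 \<le> c 0" "0 \<le> c 1" by auto
  have eq: "(\<Sum>i<length [p, q]. smult (c i) ([p, q] ! i)) = smult (c 0) p + smult (c 1) q"
    by (simp add: lessThan_Suc)
  have "real_split (smult (c 0) p + smult (c 1) q)" if "0 < c 0" "0 < c 1"
  proof (rule real_split_add(1))
    show "close_roots (smult (c 0) p) (smult (c 1) q)"
      using close that by (simp add: close_roots_def roots_ge_smult)
  qed (use p q that in \<open>auto intro: real_split_smult\<close>)
  then show "real_rooted (\<Sum>i<length [p, q]. smult (c i) ([p, q] ! i))"
    unfolding eq using c p q
    by (cases "c 0 = 0"; cases "c 1 = 0")
      (auto intro!: real_split_real_rooted real_split_smult simp: real_rooted_def[of 0])
qed

lemma T_U_op_close_roots:
  assumes f: "nonpos_split f" and g: "nonpos_split g" and close: "close_roots f g"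
    and degf: "degree f + 1 < n" and degg: "degree g < n"
  shows "nonpos_split (T_op n f)" and "nonpos_split (U_op (Suc n) g)"
    and "close_roots (T_op n f) (U_op (Suc n) g)" and "close_roots g (U_op (Suc n) g)"
proof -
  have Lg: "nonpos_split (L_op (real n) g)" by (rule L_op_nonpos_split(1)[OF g]) (use degg in simp)
  show "nonpos_split (T_op n f)"
    unfolding T_op_eq_L_op
  proof (rule L_op_nonpos_split(1))
    show "nonpos_split ([:0, 1:] * f)" using nonpos_split_linear[OF f, of 0] by simp
    show "real (degree ([:0, 1:] * f)) < real n"
      using degf degree_linear_mult[OF nonpos_splitD(2)[OF f], of 0] by simp
  qed
  show "nonpos_split (U_op (Suc n) g)"
    unfolding U_op_eq_L_op using nonpos_split_linear[OF Lg, of 0] by simp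
  show "close_roots (T_op n f) (U_op (Suc n) g)"
    unfolding T_op_eq_L_op U_op_eq_L_op by (rule close_roots_L_op[OF f g close]) (use degf degg in simp_all)
  show "close_roots g (U_op (Suc n) g)"
    unfolding close_roots_def U_op_eq_L_op roots_ge_X_mult[OF nonpos_splitD(1)[OF Lg]]
  proof
    fix t
    show "roots_ge t g \<le> of_bool (t \<le> 0) + roots_ge t (L_op (real n) g) + 1
        \<and> of_bool (t \<le> 0) + roots_ge t (L_op (real n) g) \<le> roots_ge t g + 1"
      using L_op_nonpos_split(2,3)[OF g, of "real n" t] degg by (cases "t \<le> 0") auto
  qed
qed

text \<open>Two consecutive members are carried along because \<open>Q_poly_Suc_Suc\<close> has two
  terms, and their closeness is what makes the two summands close.\<close>

lemma Q_poly_nonpos_split: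
  "nonpos_split (Q_poly a r) \<and> nonpos_split (Q_poly a (Suc r))
    \<and> close_roots (Q_poly a r) (Q_poly a (Suc r))"
proof (induction r)
  case 0
  have 0: "Q_poly a 0 = [:1:]" by (simp add: one_pCons)
  have 1: "Q_poly a (Suc 0) = [:- 0, 1:] * [:real a + 1:]"
    by (simp add: T_op_def one_pCons)
  have "nonpos_split (Q_poly a (Suc 0))"
    unfolding 1 by (intro nonpos_split_linear nonpos_split_const) auto
  moreover have "close_roots (Q_poly a 0) (Q_poly a (Suc 0))"
    unfolding 0 1 close_roots_def by (subst (1 2) roots_ge_linear) (auto intro: real_split.const)
  ultimately show ?case unfolding 0 using nonpos_split_const[of 1] by simp
next
  case (Suc r)
  let ?g = "Q_poly a (Suc r)"
  let ?A = "T_op (a + r + 2) (Q_poly a r)" and ?B = "U_op (Suc (a + r + 2)) ?g"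
  have g: "nonpos_split ?g" using Suc by blast
  have deg: "degree (Q_poly a r) + 1 < a + r + 2" "degree ?g < a + r + 2"
    using degree_Q_poly[of a r] degree_Q_poly[of a "Suc r"] by simp_all
  have A: "nonpos_split ?A" and B: "nonpos_split ?B" and AB: "close_roots ?A ?B"
    and gB: "close_roots ?g ?B"
    using T_U_op_close_roots[OF _ g _ deg] Suc by blast+
  have "?g = ?A + (- 1) ^ Suc r" by simp
  moreover have "pderiv ((- 1 :: real poly) ^ Suc r) = 0"
    by (cases "even r") (auto simp: pderiv_minus)
  ultimately have "pderiv ?g = pderiv ?A" by (metis add.right_neutral pderiv_add)
  then have gA: "close_roots ?g ?A"
    using close_roots_same_pderiv nonpos_splitD(1) g A by blast
  note between = real_split_add(2,3)[OF nonpos_splitD(1)[OF A] nonpos_splitD(1)[OF B] AB]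
  have "close_roots ?g (?A + ?B)"
    unfolding close_roots_def
  proof
    fix t
    show "roots_ge t ?g \<le> roots_ge t (?A + ?B) + 1 \<and> roots_ge t (?A + ?B) \<le> roots_ge t ?g + 1"
      using between[of t] gA[unfolded close_roots_def, rule_format, of t]
        gB[unfolded close_roots_def, rule_format, of t] by linarith
  qed
  then show ?case
    unfolding Q_poly_Suc_Suc using g nonpos_split_add[OF A B AB] by blast
qed

theorem theorem2p6:
  fixes a :: nat
  assumes "a \<ge> 1"
  shows "(\<forall>r\<ge>2. compatible [T_op (a + r) (Q_poly a (r - 2)), U_op (a + r + 1) (Q_poly a (r - 1))])
    \<and> (\<forall>r. \<forall>z::complex. poly (map_poly of_real (Q_poly a r)) z = 0 \<longrightarrow> z \<in> \<real> \<and> Re z \<le> 0)"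
proof (intro conjI allI impI)
  fix r :: nat
  assume "2 \<le> r"
  then obtain k where k: "r = k + 2" by (metis add.commute le_Suc_ex)
  have deg: "degree (Q_poly a k) + 1 < a + k + 2" "degree (Q_poly a (Suc k)) < a + k + 2"
    using degree_Q_poly[of a k] degree_Q_poly[of a "Suc k"] by simp_all
  have Q: "nonpos_split (Q_poly a k)" "nonpos_split (Q_poly a (Suc k))"
    "close_roots (Q_poly a k) (Q_poly a (Suc k))"
    using Q_poly_nonpos_split by blast+
  have "compatible [T_op (a + k + 2) (Q_poly a k), U_op (Suc (a + k + 2)) (Q_poly a (Suc k))]"
    using T_U_op_close_roots[OF Q deg] by (intro compatible_pair nonpos_splitD(1))
  then show "compatible [T_op (a + r) (Q_poly a (r - 2)), U_op (a + r + 1) (Q_poly a (r - 1))]"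
    by (simp add: k numeral_eq_Suc)
next
  fix r and z :: complex
  assume "poly (map_poly of_real (Q_poly a r)) z = 0"
  then show "z \<in> \<real>" and "Re z \<le> 0"
    using nonpos_split_complex_root Q_poly_nonpos_split by blast+
qed

end
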